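(* In the setting described in the context, assume that for almost any $t\in\Gamma$: (C1) $\varphi_f(t,\cdot)$ is three times differentiable on a neighborhood of $f(t)$; (C2) $(\varphi_f(t,\cdot))'(f(t))=0$ and $(\varphi_f(t,\cdot))''(f(t))\neq0$; (C3) there exists $\tilde C$ (independent of $t$) such that, for almost all $t\in\Gamma$, there is a neighborhood $U(t)$ of $f(t)$ with $\left|\frac{(\varphi_f(t,\cdot))'''(z)}{((\varphi_f(t,\cdot))''(z))^3}\right|\le\tilde C$ for all $z\in U(t)$. Suppose that there exist $p^\dagger\in Y^*$, single-valued and bounded almost everywhere, with $A^*p^\dagger\in\partial R(u^\dagger)$, and a strictly increasing, continuous and concave function $\Phi:[0,+\infty)\to[0,+\infty)$ with $\Phi(0)=0$ such that $$\forall p\in Y^*,\qquad\left\langle\frac{p^\dagger}{\varphi_f''(\cdot,f(\cdot))},\,p^\dagger-p\right\rangle\le\Phi\big(D_{R^*}(A^*p,A^*p^\dagger)\big),$$ where the derivative is taken with respect to the second variable of $\varphi_f$. Suppose that there exists $\zeta_\alpha^\dagger\in\partial H_f^*(-\alpha p^\dagger)$ such that $$\langle\zeta_\alpha^\dagger,p_\alpha-p^\dagger\rangle=\int_\Gamma\big((\varphi_f(t,\cdot))^*\big)'(-\alpha p^\dagger(t))\,(p_\alpha(t)-p^\dagger(t))\,dt,$$ and that there exists $C>0$ such that, for all sufficiently small $\alpha>0$, $$D^s_{H_f^*}(-\alpha p_\alpha,-\alpha p^\dagger)\ge C\alpha^2\Vert p_\alpha-p^\dagger\Vert_2^2 .$$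 Then there is a constant $\overline C$ (independent of $\alpha$) such that, for all sufficiently small $\alpha>0$, $$D_R(u_\alpha,u^\dagger)\le2\Psi(\alpha)+\Phi^{-1}\left(\alpha^2\overline C\right),$$ where $\Psi$ is the convex conjugate of the convex mapping $t\mapsto\Phi^{-1}(t)$.
   Context: $\Gamma\subset\mathbb{R}^2$ is a bounded measurable set, $X$ is a Banach space, $Y$ is a Banach space of functions on $\Gamma$, $A:X\to Y$ is a bounded linear operator, $f\in Y$. The data fidelity is $H_f(z)=\int_\Gamma\varphi_f(t,z(t))\,dt$, where $\varphi_f:\Gamma\times\mathbb{R}\to(-\infty,+\infty]$ is proper, convex and lower semicontinuous in its second variable; derivatives and the Fenchel conjugate $(\varphi_f(t,\cdot))^*$ are taken with respect to the second variable. $H_f:Y\to\mathbb{R}\cup\{+\infty\}$ and $R:X\to\mathbb{R}\cup\{+\infty\}$ are proper, convex and lower semicontinuous. "$p^\dagger\in Y^*$ single-valued and bounded a.e." means that $p^\dagger$ is given by an a.e. bounded function on $\Gamma$ acting through $\langle z,p^\dagger\rangle=\int_\Gamma z(t)p^\dagger(t)\,dt$; likewise $p_\alpha$ below is treated as a function on $\Gamma$. $u^\dagger\in\operatorname{arg\,min}\{R(u):Au=f\}$. For each $\alpha>0$ it is assumed that a minimizer $u_\alpha$ of $\frac1\alpha H_f(Au)+R(u)$ over $X$ exists, and that there is $u_0\in\operatorname{dom}(H_f\circ A)\cap\operatorname{dom}R$ such that $H_f$ is continuous at $Au_0$. Then the dual problem of minimizing $\frac1\alpha H_f^*(-\alpha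 p)+R^*(A^*p)$ over $p\in Y^*$ has a solution $p_\alpha$, and $A^*p_\alpha\in\partial R(u_\alpha)$, $\zeta_\alpha:=Au_\alpha\in\partial H_f^*(-\alpha p_\alpha)$. Bregman distances: $D_R(u,u^\dagger)=R(u)-R(u^\dagger)-\langle A^*p^\dagger,u-u^\dagger\rangle$; $D_{R^*}(A^*p,A^*p^\dagger)=R^*(A^*p)-R^*(A^*p^\dagger)-\langle u^\dagger,A^*p-A^*p^\dagger\rangle$; and $D^s_{H_f^*}(-\alpha p_\alpha,-\alpha p^\dagger)=\langle\zeta_\alpha-\zeta_\alpha^\dagger,-\alpha p_\alpha+\alpha p^\dagger\rangle$. $\Vert\cdot\Vert_2$ is the $L^2(\Gamma)$-norm. The right-hand side of the variational inequality is read as $+\infty$ when $D_{R^*}(A^*p,A^*p^\dagger)=+\infty$. $\Phi^{-1}$ is extended by $+\infty$ outside the range of $\Phi$, and $\Psi(\alpha)=\sup_{t\ge0}\{\alpha t-\Phi^{-1}(t)\}$.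
   Formalization: As printed the claim fails: the neighborhoods U(t) in (C3) may shrink with t. Added assumption: there is δ>0 with (-δ,δ) contained in the image of U(t) under (φ_f(t,·))' for almost all t. Also p†/φ_f''(·,f(·)) is taken to be an element of Y. *)

theory Defs
  imports "HOL-Analysis.Analysis"
begin

definition proper_fun :: "('a \<Rightarrow> ereal) \<Rightarrow> bool" where
  "proper_fun F \<longleftrightarrow> (\<forall>x. F x \<noteq> -\<infinity>) \<and> (\<exists>x. F x \<noteq> \<infinity>)"

definition ereal_convex :: "('a::real_vector \<Rightarrow> ereal) \<Rightarrow> bool" where
  "ereal_convex F \<longleftrightarrow> convex {(x, r::real). F x \<le> ereal r}"

definition lsc :: "('a::topological_space \<Rightarrow> ereal) \<Rightarrow> bool" where
  "lsc F \<longleftrightarrow> (\<forall>x. F x \<le> Liminf (at x) F)"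

definition fenchel :: "('a::real_normed_vector \<Rightarrow> ereal) \<Rightarrow> ('a \<Rightarrow>\<^sub>L real) \<Rightarrow> ereal" where
  "fenchel F p = (SUP x. ereal (blinfun_apply p x) - F x)"

text \<open>The conjugate of a function of one real variable, with the dual of the reals identified
  with the reals, so that it can be differentiated.\<close>

definition fenchel_real :: "(real \<Rightarrow> ereal) \<Rightarrow> real \<Rightarrow> ereal" where
  "fenchel_real g q = (SUP z. ereal (q * z) - g z)"

definition subdiff :: "('a::real_normed_vector \<Rightarrow> ereal) \<Rightarrow> 'a \<Rightarrow> ('a \<Rightarrow>\<^sub>L real) set" where
  "subdiff F x = {p. \<bar>F x\<bar> \<noteq> \<infinity> \<and> (\<forall>y. F y \<ge> F x + ereal (blinfun_apply p (y - x)))}"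

definition bregman :: "('a::real_normed_vector \<Rightarrow> ereal) \<Rightarrow> ('a \<Rightarrow>\<^sub>L real) \<Rightarrow> 'a \<Rightarrow> 'a \<Rightarrow> ereal" where
  "bregman F p x y = F x - F y - ereal (blinfun_apply p (x - y))"

text \<open>Symmetric Bregman distance of \<open>x\<close> and \<open>y\<close> for subgradients \<open>p\<close> at \<open>x\<close> and \<open>q\<close> at \<open>y\<close>;
  unlike \<open>bregman\<close> it does not involve function values.\<close>

definition sym_bregman ::
    "('a::real_normed_vector \<Rightarrow>\<^sub>L real) \<Rightarrow> ('a \<Rightarrow>\<^sub>L real) \<Rightarrow> 'a \<Rightarrow> 'a \<Rightarrow> real" where
  "sym_bregman p q x y = blinfun_apply (p - q) (x - y)"

definition bidual_embed :: "'a::real_normed_vector \<Rightarrow> (('a \<Rightarrow>\<^sub>L real) \<Rightarrow>\<^sub>L real)" where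
  "bidual_embed x = Blinfun (\<lambda>p. blinfun_apply p x)"

definition adjoint_blinfun ::
    "('a::real_normed_vector \<Rightarrow>\<^sub>L 'b::real_normed_vector) \<Rightarrow> ('b \<Rightarrow>\<^sub>L real) \<Rightarrow> ('a \<Rightarrow>\<^sub>L real)" where
  "adjoint_blinfun A p = p o\<^sub>L A"

text \<open>\<open>ext_deriv\<close> is only meaningful near points where the function is finite, since
  \<^const>\<open>real_of_ereal\<close> sends infinite values to 0; the predicates below therefore
  demand finiteness as well.\<close>

definition ext_deriv :: "nat \<Rightarrow> (real \<Rightarrow> ereal) \<Rightarrow> real \<Rightarrow> real" where
  "ext_deriv k g = (deriv ^^ k) (\<lambda>z. real_of_ereal (g z))"

definition ext_differentiable_at :: "(real \<Rightarrow> ereal) \<Rightarrow> real \<Rightarrow> bool" where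
  "ext_differentiable_at g z \<longleftrightarrow>
     (\<forall>\<^sub>F s in nhds z. \<bar>g s\<bar> \<noteq> \<infinity>) \<and> (\<lambda>s. real_of_ereal (g s)) differentiable (at z)"

definition thrice_differentiable_on :: "(real \<Rightarrow> ereal) \<Rightarrow> real set \<Rightarrow> bool" where
  "thrice_differentiable_on g U \<longleftrightarrow>
     open U \<and> (\<forall>z\<in>U. \<bar>g z\<bar> \<noteq> \<infinity> \<and> (\<forall>k<3. ext_deriv k g differentiable (at z)))"

text \<open>A Banach space of functions on \<open>\<Gamma>\<close> is a Banach space \<open>'y\<close> together with a map \<open>rep\<close>
  choosing for each element a measurable function representing it. Functions are identified when
  they agree almost everywhere on \<open>\<Gamma>\<close>, so \<open>rep\<close> is linear and injective only up to null sets.\<close>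

definition function_space :: "(real^2) set \<Rightarrow> ('y::real_normed_vector \<Rightarrow> real^2 \<Rightarrow> real) \<Rightarrow> bool" where
  "function_space \<Gamma> rep \<longleftrightarrow>
     (\<forall>z. rep z \<in> borel_measurable (lebesgue_on \<Gamma>)) \<and>
     (\<forall>z z'. AE t in lebesgue_on \<Gamma>. rep (z + z') t = rep z t + rep z' t) \<and>
     (\<forall>c z. AE t in lebesgue_on \<Gamma>. rep (c *\<^sub>R z) t = c * rep z t) \<and>
     (\<forall>z. (AE t in lebesgue_on \<Gamma>. rep z t = 0) \<longrightarrow> z = 0)"

definition acts_by ::
    "(real^2) set \<Rightarrow> ('y::real_normed_vector \<Rightarrow> real^2 \<Rightarrow> real) \<Rightarrow> ('y \<Rightarrow>\<^sub>L real) \<Rightarrow> (real^2 \<Rightarrow> real) \<Rightarrow> bool" where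
  "acts_by \<Gamma> rep p g \<longleftrightarrow> g \<in> borel_measurable (lebesgue_on \<Gamma>) \<and>
     (\<forall>z. has_bochner_integral (lebesgue_on \<Gamma>) (\<lambda>t. rep z t * g t) (blinfun_apply p z))"

text \<open>The integral of an extended-real integrand is the integral of its positive part minus that
  of its negative part, with the usual convention for integral functionals that
  \<open>\<infinity> - \<infinity> = \<infinity>\<close> (which is how \<^typ>\<open>ereal\<close> evaluates it).\<close>

definition fidelity ::
    "(real^2) set \<Rightarrow> ('y \<Rightarrow> real^2 \<Rightarrow> real) \<Rightarrow> (real^2 \<Rightarrow> real \<Rightarrow> ereal) \<Rightarrow> 'y \<Rightarrow> ereal" where
  "fidelity \<Gamma> rep \<phi> z =
     enn2ereal (\<integral>\<^sup>+t. e2ennreal (\<phi> t (rep z t)) \<partial>lebesgue_on \<Gamma>)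
     - enn2ereal (\<integral>\<^sup>+t. e2ennreal (- \<phi> t (rep z t)) \<partial>lebesgue_on \<Gamma>)"

text \<open>Infinite if the function is not square integrable.\<close>

definition L2_norm :: "(real^2) set \<Rightarrow> (real^2 \<Rightarrow> real) \<Rightarrow> ereal" where
  "L2_norm \<Gamma> g = (if integrable (lebesgue_on \<Gamma>) (\<lambda>t. (g t)\<^sup>2)
                  then ereal (sqrt (\<integral>t. (g t)\<^sup>2 \<partial>lebesgue_on \<Gamma>)) else \<infinity>)"

definition ext_inverse :: "(real \<Rightarrow> real) \<Rightarrow> real \<Rightarrow> ereal" where
  "ext_inverse \<Phi> s = (if s \<in> \<Phi> ` {0..} then ereal (the_inv_into {0..} \<Phi> s) else \<infinity>)"

definition conj_inverse :: "(real \<Rightarrow> real) \<Rightarrow> real \<Rightarrow> ereal" where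
  "conj_inverse \<Phi> \<alpha> = (SUP t\<in>{0..}. ereal (\<alpha> * t) - ext_inverse \<Phi> t)"

end

theory Submission
  imports Defs
begin

text \<open>
  Write \<open>d = p \<alpha> - p_dag\<close>. Fenchel duality makes \<open>adjoint_blinfun A (p \<alpha>)\<close> a subgradient of \<open>R\<close>
  at \<open>u \<alpha>\<close>, and then the Bregman distance \<open>D\<close> to be estimated and the dual Bregman distance
  \<open>D'\<close> of the variational inequality add up to a pairing (\<open>bregman_sum\<close>):
  \<open>D + D' = d (A (u \<alpha>)) - d f\<close>.
  The coercivity assumption replaces \<open>A (u \<alpha>)\<close> by the subgradient \<open>\<zeta>_dag \<alpha>\<close> at the price of
  \<open>- C * \<alpha> * N\<close>, where \<open>N\<close> is the squared \<open>L\<^sup>2\<close> norm of \<open>d\<close>.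

  The subgradient is given by the derivative of the conjugate integrand at \<open>- \<alpha> * p_dag_fun t\<close>. By
  the inverse function rule that derivative is \<open>rep f t\<close> at \<open>0\<close>, has slope \<open>1 / \<phi>''(t, f t)\<close> there,
  and has second derivative \<open>- \<phi>''' / (\<phi>'')^3\<close>, which is bounded. So
  (\<open>conjugate_derivative_expansion\<close>)
  it equals \<open>rep f t - \<alpha> * rep w t\<close> up to an error of order \<open>\<alpha>\<^sup>2\<close>, uniformly in \<open>t\<close> because
  \<open>p_dag_fun\<close> is bounded. Against \<open>d\<close> the error is absorbed by \<open>C * \<alpha> * N\<close>, leaving a constant times
  \<open>\<alpha>\<^sup>3\<close> (\<open>linearization_error_le\<close>). Altogether \<open>D + D' \<le> - \<alpha> * d w + \<alpha> * (\<alpha>\<^sup>2 * C_bar)\<close>.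

  The variational inequality bounds \<open>- d w\<close> by \<open>\<Phi> D'\<close>. Young's inequality for the conjugate of the
  inverse of \<open>\<Phi>\<close> gives \<open>\<alpha> * \<Phi> D' \<le> \<Psi>(\<alpha>) + D'\<close>, which cancels \<open>D'\<close>, and applied once more to
  \<open>\<alpha> * (\<alpha>\<^sup>2 * C_bar)\<close> it gives the second \<open>\<Psi>(\<alpha>)\<close> together with the inverse of \<open>\<Phi>\<close> at
  \<open>\<alpha>\<^sup>2 * C_bar\<close>.

  The duality used at the start rests on a subgradient of the value function of the perturbed primal
  problem. That function is convex and, by the continuity of \<open>H\<close> at \<open>A u0\<close>, bounded above near
  \<open>0\<close>, so the Hahn--Banach theorem provides the subgradient (\<open>convex_supporting_functional\<close>).
\<close>

section \<open>Supporting functionals of convex sets\<close>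

text \<open>The Hahn--Banach theorem, stated for cones so that Zorn's lemma can be applied to sets ordered by
  inclusion, where a chain has its union as upper bound. Let \<open>M\<close> be a maximal cone containing
  \<open>K\<close> without points \<open>(0, s)\<close>, \<open>s < 0\<close>, and \<open>q d\<close> the infimum of its fibre over \<open>d\<close>, a sublinear
  function. Adjoining the ray through \<open>(- y, - q y)\<close> cannot create such a point,
  since \<open>q\<close> bounds the fibre over \<open>t *\<^sub>R y\<close> from below; so maximality puts that ray into
  \<open>M\<close>. Hence \<open>q (- y) \<le> - q y\<close>, and a sublinear function with this property is linear.\<close>

lemma convex_cone_linear_minorant:
  fixes K :: "('a::real_vector \<times> real) set"
  assumes cone: "convex_cone K"
    and total: "\<And>d. \<exists>s. (d, s) \<in> K"
    and nonneg: "\<And>s. (0, s) \<in> K \<Longrightarrow> 0 \<le> s"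
  obtains l where "linear l" "\<And>d s. (d, s) \<in> K \<Longrightarrow> l d \<le> s"
proof -
  define \<A> where "\<A> = {L. K \<subseteq> L \<and> convex_cone L \<and> (\<forall>s. (0, s) \<in> L \<longrightarrow> 0 \<le> s)}"
  have "\<exists>M\<in>\<A>. \<forall>X\<in>\<A>. M \<subseteq> X \<longrightarrow> X = M"
  proof (rule subset_Zorn_nonempty)
    show "\<A> \<noteq> {}" using cone nonneg by (auto simp: \<A>_def)
    fix \<C> assume "\<C> \<noteq> {}" and ch: "subset.chain \<A> \<C>"
    then have sub: "\<And>L. L \<in> \<C> \<Longrightarrow> L \<in> \<A>" by (auto simp: subset.chain_def)
    have "convex_cone (\<Union>\<C>)"
      unfolding convex_cone_iff
    proof (intro conjI ballI allI impI)
      show "0 \<in> \<Union>\<C>"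
        using \<open>\<C> \<noteq> {}\<close> sub by (fastforce simp: \<A>_def convex_cone_iff)
    next
      fix x y assume "x \<in> \<Union>\<C>" "y \<in> \<Union>\<C>"
      then obtain X Y where XY: "X \<in> \<C>" "x \<in> X" "Y \<in> \<C>" "y \<in> Y" by blast
      then have "X \<subseteq> Y \<or> Y \<subseteq> X" using ch by (auto simp: subset.chain_def)
      then obtain Z where "Z \<in> \<C>" "x \<in> Z" "y \<in> Z" using XY by blast
      then show "x + y \<in> \<Union>\<C>"
        using sub[of Z] convex_cone_add[of Z x y] unfolding \<A>_def by blast
    next
      fix x and c :: real assume "x \<in> \<Union>\<C>" "0 \<le> c"
      then show "c *\<^sub>R x \<in> \<Union>\<C>" using sub by (auto simp: \<A>_def convex_cone_iff)
    qed
    then show "\<Union>\<C> \<in> \<A>"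
      using \<open>\<C> \<noteq> {}\<close> sub unfolding \<A>_def by blast
  qed
  then obtain M where "M \<in> \<A>" and maximal: "\<And>X. X \<in> \<A> \<Longrightarrow> M \<subseteq> X \<Longrightarrow> X = M" by blast
  then have KM: "K \<subseteq> M" and M: "convex_cone M" and M_nonneg: "\<And>s. (0, s) \<in> M \<Longrightarrow> 0 \<le> s"
    by (auto simp: \<A>_def)
  define q where "q d = Inf {s. (d, s) \<in> M}" for d
  have nonempty: "\<exists>s. (d, s) \<in> M" for d using total KM by blast
  have bdd: "bdd_below {s. (d, s) \<in> M}" for d
  proof -
    obtain r where "(- d, r) \<in> M" using nonempty by blast
    then have "- r \<le> s" if "(d, s) \<in> M" for s
      using M_nonneg[of "s + r"] convex_cone_add[OF M that, of "(- d, r)"] by simp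
    then show ?thesis unfolding bdd_below_def by blast
  qed
  have lower: "q d \<le> s" if "(d, s) \<in> M" for d s
    unfolding q_def using that bdd by (auto intro: cInf_lower)
  have greatest: "x \<le> q d" if "\<And>s. (d, s) \<in> M \<Longrightarrow> x \<le> s" for x d
    unfolding q_def using that nonempty by (intro cInf_greatest) auto
  have subadd: "q (x + y) \<le> q x + q y" for x y
  proof -
    have "q (x + y) - q y \<le> r" if r: "(x, r) \<in> M" for r
    proof -
      have "q (x + y) - r \<le> s" if "(y, s) \<in> M" for s
        using lower[of "x + y" "r + s"] convex_cone_add[OF M r that] by simp
      then have "q (x + y) - r \<le> q y" by (rule greatest)
      then show ?thesis by simp
    qed
    then have "q (x + y) - q y \<le> q x" by (rule greatest)
    then show ?thesis by simp
  qed
  have scale: "q (c *\<^sub>R x) \<le> c * q x" if "c > 0" for c x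
  proof -
    have "q (c *\<^sub>R x) / c \<le> s" if "(x, s) \<in> M" for s
      using lower convex_cone_scaleR[OF M _ that, of c] \<open>c > 0\<close> by (simp add: field_simps)
    then have "q (c *\<^sub>R x) / c \<le> q x" by (rule greatest)
    then show ?thesis using \<open>c > 0\<close> by (simp add: field_simps)
  qed
  have zero: "q 0 = 0"
  proof (rule antisym)
    show "q 0 \<le> 0" using lower[of 0 0] convex_cone_contains_0[OF M] by (simp add: zero_prod_def)
  qed (rule greatest[OF M_nonneg])
  have odd: "q (- y) = - q y" for y
  proof -
    define L where "L = {a + t *\<^sub>R (- y, - q y) | a t. a \<in> M \<and> 0 \<le> t}"
    have "convex_cone L"
      unfolding convex_cone_iff
    proof (intro conjI ballI allI impI)
      show "0 \<in> L" unfolding L_def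
        using convex_cone_contains_0[OF M] by (intro CollectI exI[of _ 0] exI[of _ 0]) (auto simp: zero_prod_def)
    next
      fix a b assume "a \<in> L" "b \<in> L"
      then obtain a' s b' t where *: "a = a' + s *\<^sub>R (- y, - q y)" "a' \<in> M" "0 \<le> s"
        "b = b' + t *\<^sub>R (- y, - q y)" "b' \<in> M" "0 \<le> t" unfolding L_def by blast
      have "a + b = (a' + b') + (s + t) *\<^sub>R (- y, - q y)"
        using * by (simp only: scaleR_left_distrib) (simp add: ac_simps)
      then show "a + b \<in> L" unfolding L_def using * convex_cone_add[OF M]
        by (intro CollectI exI[of _ "a' + b'"] exI[of _ "s + t"]) auto
    next
      fix a and c :: real assume "a \<in> L" "0 \<le> c"
      then obtain a' s where *: "a = a' + s *\<^sub>R (- y, - q y)" "a' \<in> M" "0 \<le> s" unfolding L_def by blast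
      have "c *\<^sub>R a = c *\<^sub>R a' + (c * s) *\<^sub>R (- y, - q y)"
        using * by (simp only: scaleR_right_distrib scaleR_scaleR)
      then show "c *\<^sub>R a \<in> L" unfolding L_def using * \<open>0 \<le> c\<close> convex_cone_scaleR[OF M]
        by (intro CollectI exI[of _ "c *\<^sub>R a'"] exI[of _ "c * s"]) auto
    qed
    moreover have "M \<subseteq> L"
    proof
      fix a assume "a \<in> M"
      then show "a \<in> L" unfolding L_def by (intro CollectI exI[of _ a] exI[of _ 0]) (auto simp: zero_prod_def)
    qed
    moreover have "0 \<le> s" if "(0, s) \<in> L" for s
    proof -
      from that obtain b t where t: "(t *\<^sub>R y, b) \<in> M" "s = b - t * q y" "0 \<le> t"
        unfolding L_def by auto
      show ?thesis
      proof (cases "t = 0")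
        case True
        then show ?thesis using t M_nonneg by simp
      next
        case False
        have "q ((1 / t) *\<^sub>R t *\<^sub>R y) \<le> (1 / t) * q (t *\<^sub>R y)"
          using False t(3) by (intro scale) auto
        then have "t * q y \<le> q (t *\<^sub>R y)" using False t(3) by (simp add: field_simps)
        then show ?thesis using lower[OF t(1)] t(2) by simp
      qed
    qed
    ultimately have "L = M" using KM maximal[of L] by (auto simp: \<A>_def)
    have "(- y, - q y) \<in> L" unfolding L_def
      using convex_cone_contains_0[OF M] by (intro CollectI exI[of _ 0] exI[of _ 1]) (auto simp: zero_prod_def)
    then have "q (- y) \<le> - q y" using \<open>L = M\<close> lower by simp
    moreover have "0 \<le> q y + q (- y)" using subadd[of y "- y"] zero by simp
    ultimately show ?thesis by simp
  qed
  have "linear q"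
  proof (rule linearI)
    fix x y :: 'a
    have "q (- x + - y) \<le> q (- x) + q (- y)" by (rule subadd)
    then have "q x + q y \<le> q (x + y)" using odd[of x] odd[of y] odd[of "x + y"] by simp
    then show "q (x + y) = q x + q y" using subadd[of x y] by simp
  next
    fix c :: real and x :: 'a
    have pos: "q (c *\<^sub>R x) = c * q x" if "c > 0" for c :: real and x
    proof -
      have "- q (c *\<^sub>R x) \<le> c * - q x" using scale[OF that, of "- x"] by (simp add: odd)
      then show ?thesis using scale[OF that, of x] by simp
    qed
    consider "c = 0" | "c > 0" | "c < 0" by linarith
    then show "q (c *\<^sub>R x) = c *\<^sub>R q x"
    proof cases
      case 3
      then show ?thesis using pos[of "- c" x] odd[of "c *\<^sub>R x"] by simp
    qed (use zero pos in auto)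
  qed
  then show ?thesis using that lower KM by blast
qed

text \<open>A convex function has a continuous subgradient at a point in whose neighbourhood it is bounded
  above. Here \<open>E\<close> plays the role of the epigraph and \<open>(0, m)\<close> of the point on its graph. The cone
  generated by \<open>E - (0, m)\<close> meets every vertical line because \<open>E\<close> contains points above a whole ball,
  and the same ball bounds the resulting linear functional.\<close>

lemma convex_supporting_functional:
  fixes E :: "('a::real_normed_vector \<times> real) set"
  assumes "convex E" and "(0, m) \<in> E" and min: "\<And>r. (0, r) \<in> E \<Longrightarrow> m \<le> r"
    and "e > 0" and top: "\<And>y. norm y < e \<Longrightarrow> (y, k) \<in> E"
  obtains l :: "'a \<Rightarrow>\<^sub>L real" where "\<And>y r. (y, r) \<in> E \<Longrightarrow> m + blinfun_apply l y \<le> r"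
proof -
  define K where "K = conic hull ((\<lambda>a. (0, - m) + a) ` E)"
  have K: "K = {c *\<^sub>R (y, r - m) | c y r. 0 \<le> c \<and> (y, r) \<in> E}"
    unfolding K_def conic_hull_explicit by force
  have "convex_cone K"
    unfolding convex_cone_def K_def
    using assms(1,2) by (auto simp: convex_conic_hull conic_conic_hull conic_hull_eq_empty convex_translation)
  moreover have "\<exists>s. (d, s) \<in> K" for d
  proof -
    define c where "c = 2 * (norm d + 1) / e"
    have "c > 0" unfolding c_def using \<open>e > 0\<close> by (simp add: add_nonneg_pos)
    have "norm ((1 / c) *\<^sub>R d) < e"
      using \<open>c > 0\<close> \<open>e > 0\<close> norm_ge_zero[of d] unfolding c_def
      by (simp add: divide_simps) (smt (verit) norm_ge_zero)
    then have "((1 / c) *\<^sub>R d, k) \<in> E" by (rule top)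
    then have "c *\<^sub>R ((1 / c) *\<^sub>R d, k - m) \<in> K" using K \<open>c > 0\<close> by fastforce
    then show ?thesis using \<open>c > 0\<close> by auto
  qed
  moreover have "0 \<le> s" if "(0, s) \<in> K" for s
    using that min unfolding K by force
  ultimately obtain l where "linear l" and l: "\<And>d s. (d, s) \<in> K \<Longrightarrow> l d \<le> s"
    using convex_cone_linear_minorant by blast
  have le: "m + l y \<le> r" if "(y, r) \<in> E" for y r
  proof -
    have "1 *\<^sub>R (y, r - m) \<in> K" unfolding K using that by fastforce
    then show ?thesis using l[of y "r - m"] by simp
  qed
  have "bounded_linear l"
  proof (rule bounded_linear_intro)
    fix d
    have half: "l d \<le> norm d * (2 * (k - m) / e)" for d
    proof (cases "d = 0")
      case True
      then show ?thesis using \<open>linear l\<close> by (simp add: linear_0)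
    next
      case False
      define c where "c = e / (2 * norm d)"
      have "c > 0" unfolding c_def using False \<open>e > 0\<close> by simp
      have "norm (c *\<^sub>R d) < e" using False \<open>e > 0\<close> by (simp add: c_def)
      then have "m + c * l d \<le> k"
        using le[OF top, of "c *\<^sub>R d"] \<open>linear l\<close> by (simp add: linear_scale)
      then show ?thesis using \<open>c > 0\<close> False \<open>e > 0\<close> by (simp add: c_def field_simps)
    qed
    show "norm (l d) \<le> norm d * (2 * (k - m) / e)"
      using half[of d] half[of "- d"] \<open>linear l\<close> by (simp add: linear_neg abs_le_iff)
  qed (use \<open>linear l\<close> in \<open>auto simp: linear_add linear_scale\<close>)
  then have "blinfun_apply (Blinfun l) = l" by (rule bounded_linear_Blinfun_apply)
  then show ?thesis using that[of "Blinfun l"] le by simp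
qed

section \<open>Fenchel duality and Bregman distances\<close>

lemma ereal_convexD:
  assumes "ereal_convex F" "F x \<le> ereal a" "F y \<le> ereal b" "0 \<le> s" "0 \<le> t" "s + t = 1"
  shows "F (s *\<^sub>R x + t *\<^sub>R y) \<le> ereal (s * a + t * b)"
  using convexD[of "{(x, r). F x \<le> ereal r}" "(x, a)" "(y, b)" s t] assms
  by (auto simp: ereal_convex_def)

lemma fenchel_young: "ereal (blinfun_apply p x) - F x \<le> fenchel F p"
  unfolding fenchel_def by (rule SUP_upper) simp

lemma proper_fun_real_le:
  assumes "proper_fun F" "F x \<noteq> \<infinity>"
  shows "\<exists>r. F x = ereal r"
  using assms by (cases "F x") (auto simp: proper_fun_def)

text \<open>The inequality that carries Fenchel duality: some dual element \<open>q\<close> attains a value not above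
  minus the minimum of the primal problem. Perturb the primal problem to minimizing
  \<open>H (A v + y) / \<alpha> + R v\<close>; its value is convex in \<open>y\<close>, and continuity of \<open>H\<close> at \<open>A u0\<close> bounds it
  above for small \<open>y\<close>, so it has a continuous subgradient \<open>l\<close> at \<open>y = 0\<close>. The substitution
  \<open>y = z - A v\<close> separates the variables in the subgradient inequality, and taking suprema over \<open>z\<close>
  and \<open>v\<close> yields the two conjugates at \<open>q = - l\<close>.\<close>

lemma fenchel_strong_duality:
  fixes A :: "'x::real_normed_vector \<Rightarrow>\<^sub>L 'y::real_normed_vector"
  assumes "proper_fun H" "ereal_convex H" "proper_fun R" "ereal_convex R" and "\<alpha> > 0"
    and min: "is_arg_min (\<lambda>v. ereal (1 / \<alpha>) * H (A v) + R v) (\<lambda>_. True) u"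
    and u0: "H (A u0) < \<infinity>" "R u0 < \<infinity>" "isCont H (A u0)"
  shows "\<exists>h r q. H (A u) = ereal h \<and> R u = ereal r \<and>
    ereal (1 / \<alpha>) * fenchel H (- \<alpha> *\<^sub>R q) + fenchel R (adjoint_blinfun A q) \<le> ereal (- (h / \<alpha> + r))"
proof -
  have le: "ereal (1 / \<alpha>) * H (A u) + R u \<le> ereal (1 / \<alpha>) * H (A v) + R v" for v
    using min by (auto simp: is_arg_min_linorder)
  obtain h0 r0 where h0: "H (A u0) = ereal h0" and r0: "R u0 = ereal r0"
    using proper_fun_real_le[OF assms(1), of "A u0"] proper_fun_real_le[OF assms(3), of u0] u0 by auto
  have "H (A u) \<noteq> - \<infinity>" "R u \<noteq> - \<infinity>" using assms(1,3) by (auto simp: proper_fun_def)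
  then obtain h r where h: "H (A u) = ereal h" and r: "R u = ereal r"
    using le[of u0] h0 r0 \<open>\<alpha> > 0\<close> by (cases "H (A u)"; cases "R u") auto
  define m where "m = h / \<alpha> + r"
  (* the epigraph of the perturbed value function, written without infima so that no
     attainment or finiteness question arises *)
  define E where "E = {(y, a / \<alpha> + b) | y a b. \<exists>v. H (A v + y) \<le> ereal a \<and> R v \<le> ereal b}"
  have E: "(y, a / \<alpha> + b) \<in> E" if "H (A v + y) \<le> ereal a" "R v \<le> ereal b" for y v a b
    unfolding E_def using that by blast
  have "convex E"
  proof (rule convexI)
    fix x y and s t :: real assume "x \<in> E" "y \<in> E" and st: "0 \<le> s" "0 \<le> t" "s + t = 1"
    then obtain x' a b v y' c d w where *: "x = (x', a / \<alpha> + b)" "H (A v + x') \<le> ereal a" "R v \<le> ereal b"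
      "y = (y', c / \<alpha> + d)" "H (A w + y') \<le> ereal c" "R w \<le> ereal d"
      unfolding E_def by blast
    have "H (A (s *\<^sub>R v + t *\<^sub>R w) + (s *\<^sub>R x' + t *\<^sub>R y')) \<le> ereal (s * a + t * c)"
      using ereal_convexD[OF assms(2) *(2,5) st]
      by (simp add: blinfun.add_right blinfun.scaleR_right scaleR_right_distrib ac_simps)
    moreover have "R (s *\<^sub>R v + t *\<^sub>R w) \<le> ereal (s * b + t * d)"
      using ereal_convexD[OF assms(4) *(3,6) st] .
    ultimately have "(s *\<^sub>R x' + t *\<^sub>R y', (s * a + t * c) / \<alpha> + (s * b + t * d)) \<in> E"
      by (rule E)
    then show "s *\<^sub>R x + t *\<^sub>R y \<in> E"
      using * \<open>\<alpha> > 0\<close> by (simp add: add_divide_distrib algebra_simps)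
  qed
  moreover have "(0, m) \<in> E" unfolding m_def using h r by (intro E[of u]) auto
  moreover have "m \<le> k" if "(0, k) \<in> E" for k
  proof -
    from that obtain a b v where k: "k = a / \<alpha> + b" "H (A v) \<le> ereal a" "R v \<le> ereal b"
      unfolding E_def by auto
    have "ereal m = ereal (1 / \<alpha>) * H (A u) + R u" using h r by (simp add: m_def)
    also have "\<dots> \<le> ereal (1 / \<alpha>) * H (A v) + R v" by (rule le)
    also have "\<dots> \<le> ereal (1 / \<alpha>) * ereal a + ereal b"
      using k \<open>\<alpha> > 0\<close> by (intro add_mono ereal_mult_left_mono) auto
    finally show ?thesis using k by simp
  qed
  moreover obtain e where "e > 0" and e: "\<And>y. norm y < e \<Longrightarrow> (y, (h0 + 1) / \<alpha> + r0) \<in> E"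
  proof -
    have "\<forall>\<^sub>F z in nhds (A u0). H z < ereal (h0 + 1)"
      using u0(3)[unfolded continuous_at tendsto_at_iff_tendsto_nhds] h0
      by (intro order_tendstoD(2)) auto
    then obtain e where "e > 0" and *: "\<And>z. dist z (A u0) < e \<Longrightarrow> H z < ereal (h0 + 1)"
      by (auto simp: eventually_nhds_metric)
    have "(y, (h0 + 1) / \<alpha> + r0) \<in> E" if "norm y < e" for y
      using *[of "A u0 + y"] that r0 by (intro E[of u0]) (auto simp: dist_norm)
    then show thesis using that \<open>e > 0\<close> by blast
  qed
  ultimately obtain l :: "'y \<Rightarrow>\<^sub>L real" where l: "\<And>y k. (y, k) \<in> E \<Longrightarrow> m + l y \<le> k"
    by (rule convex_supporting_functional) blast+
  have split: "l z - a / \<alpha> + (- l (A v) - b) \<le> - m" if "H z \<le> ereal a" "R v \<le> ereal b" for z v a b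
  proof -
    have "m + l (z - A v) \<le> a / \<alpha> + b" using that by (intro l E[of v]) auto
    then show ?thesis by (simp add: blinfun.diff_right)
  qed
  define q where "q = - l"
  have H_le: "fenchel H (- \<alpha> *\<^sub>R q) \<le> ereal (\<alpha> * (- m + l (A v) + b))" if "R v \<le> ereal b" for v b
    unfolding fenchel_def
  proof (rule SUP_least)
    fix z
    show "ereal ((- \<alpha> *\<^sub>R q) z) - H z \<le> ereal (\<alpha> * (- m + l (A v) + b))"
    proof (cases "H z")
      case (real a)
      then have "l z - a / \<alpha> \<le> - m + l (A v) + b" using split[of z a v b] that by simp
      then have "\<alpha> * (l z - a / \<alpha>) \<le> \<alpha> * (- m + l (A v) + b)" using \<open>\<alpha> > 0\<close> by (intro mult_left_mono) auto
      then show ?thesis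
        using real \<open>\<alpha> > 0\<close> by (simp add: q_def blinfun.scaleR_left blinfun.minus_left right_diff_distrib)
    qed (use assms(1) in \<open>auto simp: proper_fun_def\<close>)
  qed
  have "fenchel H (- \<alpha> *\<^sub>R q) \<noteq> - \<infinity>"
    using fenchel_young[of "- \<alpha> *\<^sub>R q" "A u" H] h by auto
  moreover have "fenchel H (- \<alpha> *\<^sub>R q) \<noteq> \<infinity>"
    using H_le[of u r] r by auto
  ultimately obtain c where c: "fenchel H (- \<alpha> *\<^sub>R q) = ereal c"
    by (cases "fenchel H (- \<alpha> *\<^sub>R q)") auto
  have "fenchel R (adjoint_blinfun A q) \<le> ereal (- m - c / \<alpha>)"
    unfolding fenchel_def
  proof (rule SUP_least)
    fix v
    show "ereal (adjoint_blinfun A q v) - R v \<le> ereal (- m - c / \<alpha>)"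
    proof (cases "R v")
      case (real b)
      then have "c \<le> \<alpha> * (- m + l (A v) + b)" using H_le[of v b] c by simp
      then show ?thesis using real \<open>\<alpha> > 0\<close>
        by (simp add: q_def adjoint_blinfun_def blinfun.minus_left field_simps)
    qed (use assms(3) in \<open>auto simp: proper_fun_def\<close>)
  qed
  then have "ereal (1 / \<alpha>) * fenchel H (- \<alpha> *\<^sub>R q) + fenchel R (adjoint_blinfun A q)
      \<le> ereal (1 / \<alpha>) * ereal c + ereal (- m - c / \<alpha>)"
    unfolding c by (intro add_mono) auto
  then show ?thesis using h r by (auto simp: m_def)
qed

text \<open>A dual minimizer is at least as good as the dual element of
  \<open>fenchel_strong_duality\<close>. The two Fenchel--Young inequalities, at \<open>A u\<close> and at \<open>u\<close>, bound
  its dual value from below by the same number, so both are equalities. The one for \<open>R\<close> expresses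
  \<open>adjoint_blinfun A p \<in> subdiff R u\<close>.\<close>

lemma dual_minimizer_extremal:
  fixes A :: "'x::real_normed_vector \<Rightarrow>\<^sub>L 'y::real_normed_vector"
  assumes "proper_fun H" "ereal_convex H" "proper_fun R" "ereal_convex R" and "\<alpha> > 0"
    and "is_arg_min (\<lambda>v. ereal (1 / \<alpha>) * H (A v) + R v) (\<lambda>_. True) u"
    and "H (A u0) < \<infinity>" "R u0 < \<infinity>" "isCont H (A u0)"
    and dual: "is_arg_min (\<lambda>q. ereal (1 / \<alpha>) * fenchel H (- \<alpha> *\<^sub>R q) + fenchel R (adjoint_blinfun A q))
             (\<lambda>_. True) p"
  shows "\<exists>r. R u = ereal r \<and> fenchel R (adjoint_blinfun A p) = ereal (p (A u) - r)"
proof -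
  obtain h r q where h: "H (A u) = ereal h" and r: "R u = ereal r" and
    q: "ereal (1 / \<alpha>) * fenchel H (- \<alpha> *\<^sub>R q) + fenchel R (adjoint_blinfun A q) \<le> ereal (- (h / \<alpha> + r))"
    using fenchel_strong_duality[OF assms(1-9)] by blast
  have le: "ereal (1 / \<alpha>) * fenchel H (- \<alpha> *\<^sub>R p) + fenchel R (adjoint_blinfun A p) \<le> ereal (- (h / \<alpha> + r))"
    using dual q by (auto simp: is_arg_min_linorder intro: order_trans)
  have H: "ereal (- \<alpha> * p (A u) - h) \<le> fenchel H (- \<alpha> *\<^sub>R p)"
    using fenchel_young[of "- \<alpha> *\<^sub>R p" "A u" H] h by (simp add: blinfun.scaleR_left blinfun.minus_left)
  have R: "ereal (p (A u) - r) \<le> fenchel R (adjoint_blinfun A p)"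
    using fenchel_young[of "adjoint_blinfun A p" u R] r by (simp add: adjoint_blinfun_def)
  obtain a b where a: "fenchel H (- \<alpha> *\<^sub>R p) = ereal a" and b: "fenchel R (adjoint_blinfun A p) = ereal b"
    using le H R \<open>\<alpha> > 0\<close>
    by (cases "fenchel H (- \<alpha> *\<^sub>R p)"; cases "fenchel R (adjoint_blinfun A p)") auto
  have "a / \<alpha> + b \<le> - (h / \<alpha> + r)" using le a b by simp
  moreover have "(- \<alpha> * p (A u) - h) / \<alpha> \<le> a / \<alpha>"
    using H a \<open>\<alpha> > 0\<close> by (intro divide_right_mono) auto
  moreover have "(- \<alpha> * p (A u) - h) / \<alpha> = - p (A u) - h / \<alpha>"
    using \<open>\<alpha> > 0\<close> by (simp add: field_simps)
  ultimately have "b \<le> p (A u) - r" by simp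
  then show ?thesis using R b r by auto
qed

lemma bidual_embed_apply [simp]: "blinfun_apply (bidual_embed x) p = blinfun_apply p x"
  unfolding bidual_embed_def
  by (subst bounded_linear_Blinfun_apply)
    (auto intro: blinfun.bounded_linear_left)

text \<open>Equality holds in the Fenchel--Young inequalities for \<open>R\<close> at both pairs of primal and dual
  elements, so in the sum of the two Bregman distances all function values cancel and a duality
  pairing remains. Nonnegativity of the dual distance is the Fenchel--Young inequality
  for the mixed pair.\<close>

lemma bregman_sum:
  fixes A :: "'x::real_normed_vector \<Rightarrow>\<^sub>L 'y::real_normed_vector"
  assumes "A u_dag = f" and src: "adjoint_blinfun A p_dag \<in> subdiff R u_dag"
    and ext: "R u = ereal r" "fenchel R (adjoint_blinfun A p) = ereal (p (A u) - r)"
  shows "\<exists>D D'. bregman R (adjoint_blinfun A p_dag) u u_dag = ereal D \<and>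
    bregman (fenchel R) (bidual_embed u_dag) (adjoint_blinfun A p) (adjoint_blinfun A p_dag) = ereal D' \<and>
    0 \<le> D' \<and> D + D' = (p - p_dag) (A u) - (p - p_dag) f"
proof -
  obtain r' where r': "R u_dag = ereal r'" using src by (auto simp: subdiff_def)
  have "fenchel R (adjoint_blinfun A p_dag) = ereal (p_dag f - r')"
  proof (rule antisym)
    show "fenchel R (adjoint_blinfun A p_dag) \<le> ereal (p_dag f - r')"
      unfolding fenchel_def
    proof (rule SUP_least)
      fix v
      have "R u_dag + ereal (adjoint_blinfun A p_dag (v - u_dag)) \<le> R v"
        using src by (auto simp: subdiff_def)
      then show "ereal (adjoint_blinfun A p_dag v) - R v \<le> ereal (p_dag f - r')"
        using r' assms(1) by (cases "R v") (auto simp: adjoint_blinfun_def blinfun.diff_right)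
    qed
    show "ereal (p_dag f - r') \<le> fenchel R (adjoint_blinfun A p_dag)"
      using fenchel_young[of "adjoint_blinfun A p_dag" u_dag R] r' assms(1)
      by (simp add: adjoint_blinfun_def)
  qed
  moreover have "p f - r' \<le> p (A u) - r"
    using fenchel_young[of "adjoint_blinfun A p" u_dag R] r' assms(1) ext
    by (simp add: adjoint_blinfun_def)
  ultimately show ?thesis
    using r' ext assms(1)
    by (auto simp: bregman_def adjoint_blinfun_def blinfun.diff_left blinfun.diff_right)
qed

section \<open>The derivative of the conjugate integrand\<close>

lemma thrice_differentiable_onD:
  assumes "thrice_differentiable_on g U" "z \<in> U"
  shows "g z = ereal (real_of_ereal (g z))"
    and "((\<lambda>z. real_of_ereal (g z)) has_real_derivative ext_deriv 1 g z) (at z)"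
    and "(ext_deriv 1 g has_real_derivative ext_deriv 2 g z) (at z)"
    and "(ext_deriv 2 g has_real_derivative ext_deriv 3 g z) (at z)"
proof -
  have fin: "\<bar>g z\<bar> \<noteq> \<infinity>" and diff: "\<And>k. k < 3 \<Longrightarrow> ext_deriv k g differentiable (at z)"
    using assms by (auto simp: thrice_differentiable_on_def)
  show "g z = ereal (real_of_ereal (g z))" using fin by (simp add: ereal_real)
  have step: "(ext_deriv k g has_real_derivative ext_deriv (Suc k) g z) (at z)" if "k < 3" for k
    using diff[OF that] by (simp add: ext_deriv_def real_differentiable_def DERIV_deriv_iff_real_differentiable)
  show "((\<lambda>z. real_of_ereal (g z)) has_real_derivative ext_deriv 1 g z) (at z)"
    using step[of 0] by (simp add: ext_deriv_def)
  show "(ext_deriv 1 g has_real_derivative ext_deriv 2 g z) (at z)"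
    using step[of 1] by (simp add: numeral_2_eq_2)
  show "(ext_deriv 2 g has_real_derivative ext_deriv 3 g z) (at z)"
    using step[of 2] by (simp add: numeral_3_eq_3 numeral_2_eq_2)
qed

text \<open>Convexity bounds the difference quotients of \<open>g\<close> along the segment from \<open>z\<close> to \<open>y\<close> by the slope
  of the chord, and they converge to the directional derivative at \<open>z\<close>. Only \<open>z\<close> has to lie in the
  region of smoothness, so this remains true when \<open>g\<close> is infinite somewhere.\<close>

lemma convex_derivative_supports:
  assumes "proper_fun g" "ereal_convex g" "thrice_differentiable_on g U" "z \<in> U"
  shows "ereal (real_of_ereal (g z) + ext_deriv 1 g z * (y - z)) \<le> g y"
proof (cases "g y")
  case (real r)
  define G where "G = (\<lambda>x. real_of_ereal (g x))"
  have gz: "g z = ereal (G z)" unfolding G_def using thrice_differentiable_onD(1)[OF assms(3,4)] .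
  have "((\<lambda>t. G (z + t * (y - z))) has_real_derivative ext_deriv 1 g z * (y - z)) (at 0)"
    using thrice_differentiable_onD(2)[OF assms(3,4)] unfolding G_def
    by (intro DERIV_chain2[where g = "\<lambda>t. z + t * (y - z)"]) (auto intro!: derivative_eq_intros)
  then have "((\<lambda>t. (G (z + t * (y - z)) - G z) / t) \<longlongrightarrow> ext_deriv 1 g z * (y - z)) (at 0)"
    by (simp add: has_field_derivative_iff)
  then have lim: "((\<lambda>t. (G (z + t * (y - z)) - G z) / t) \<longlongrightarrow> ext_deriv 1 g z * (y - z)) (at_right 0)"
    by (rule tendsto_mono[rotated]) (simp add: at_le)
  have "((\<lambda>t. z + t * (y - z)) \<longlongrightarrow> z + 0 * (y - z)) (at_right 0)" by (intro tendsto_intros)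
  then have near: "\<forall>\<^sub>F t in at_right 0. z + t * (y - z) \<in> U"
    using assms(3,4) by (auto simp: thrice_differentiable_on_def intro: topological_tendstoD)
  have "\<forall>\<^sub>F t in at_right 0. (0::real) < t \<and> t < 1"
    by (intro eventually_conj eventually_at_right_less eventually_at_rightI[of _ 1]) auto
  with near have "\<forall>\<^sub>F t in at_right 0. (G (z + t * (y - z)) - G z) / t \<le> r - G z"
  proof eventually_elim
    case (elim t)
    have "g ((1 - t) *\<^sub>R z + t *\<^sub>R y) \<le> ereal ((1 - t) * G z + t * r)"
      using elim gz real by (intro ereal_convexD[OF assms(2)]) auto
    moreover have "(1 - t) *\<^sub>R z + t *\<^sub>R y = z + t * (y - z)" by (simp add: algebra_simps)
    moreover have "g (z + t * (y - z)) = ereal (G (z + t * (y - z)))"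
      unfolding G_def using thrice_differentiable_onD(1)[OF assms(3)] elim by blast
    ultimately have "G (z + t * (y - z)) - G z \<le> t * (r - G z)" by (simp add: algebra_simps)
    then show ?case using elim by (simp add: field_simps)
  qed
  then have "ext_deriv 1 g z * (y - z) \<le> r - G z"
    using lim by (intro tendsto_upperbound) auto
  then show ?thesis using real unfolding G_def by simp
qed (use assms(1) in \<open>auto simp: proper_fun_def\<close>)

text \<open>The set \<open>U\<close> need not be connected, so a sign of the second derivative on \<open>U\<close> does not give
  strict monotonicity by the mean value theorem. The derivative is nondecreasing on \<open>U\<close> by convexity
  across the gaps; if it took the same value at two points, it would be constant on \<open>U\<close> in between,
  which the nonzero second derivative forbids immediately to the right of the left point.\<close>

lemma convex_derivative_inj_on:
  assumes "proper_fun g" "ereal_convex g" "thrice_differentiable_on g U"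
    and second: "\<And>z. z \<in> U \<Longrightarrow> ext_deriv 2 g z \<noteq> 0"
  shows "inj_on (ext_deriv 1 g) U"
proof -
  have mono: "ext_deriv 1 g x \<le> ext_deriv 1 g y" if "x \<in> U" "y \<in> U" "x < y" for x y
  proof -
    have "real_of_ereal (g x) + ext_deriv 1 g x * (y - x) \<le> real_of_ereal (g y)"
      using convex_derivative_supports[OF assms(1-3) \<open>x \<in> U\<close>, of y]
        thrice_differentiable_onD(1)[OF assms(3) \<open>y \<in> U\<close>] by (metis ereal_less_eq(3))
    moreover have "real_of_ereal (g y) + ext_deriv 1 g y * (x - y) \<le> real_of_ereal (g x)"
      using convex_derivative_supports[OF assms(1-3) \<open>y \<in> U\<close>, of x]
        thrice_differentiable_onD(1)[OF assms(3) \<open>x \<in> U\<close>] by (metis ereal_less_eq(3))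
    ultimately have "ext_deriv 1 g x * (y - x) \<le> ext_deriv 1 g y * (y - x)" by (simp add: algebra_simps)
    then show ?thesis using that by simp
  qed
  have neq: "ext_deriv 1 g x \<noteq> ext_deriv 1 g y" if "x \<in> U" "y \<in> U" "x < y" for x y
  proof
    assume eq: "ext_deriv 1 g x = ext_deriv 1 g y"
    have D: "DERIV (ext_deriv 1 g) x :> ext_deriv 2 g x"
      using thrice_differentiable_onD(3)[OF assms(3) \<open>x \<in> U\<close>] .
    obtain d where "d > 0" and d: "\<And>h. 0 < h \<Longrightarrow> h < d \<Longrightarrow> ext_deriv 1 g (x + h) \<noteq> ext_deriv 1 g x"
    proof (cases "ext_deriv 2 g x > 0")
      case True
      then show thesis using DERIV_pos_inc_right[OF D] that by (metis less_irrefl)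
    next
      case False
      then have "ext_deriv 2 g x < 0" using second[OF \<open>x \<in> U\<close>] by simp
      then show thesis using DERIV_neg_dec_right[OF D] that by (metis less_irrefl)
    qed
    obtain e where "e > 0" and e: "ball x e \<subseteq> U"
      using assms(3) \<open>x \<in> U\<close> by (auto simp: thrice_differentiable_on_def open_contains_ball)
    define h where "h = min (min d e) (y - x) / 2"
    have h: "0 < h" "h < d" "h < e" "h < y - x" using \<open>d > 0\<close> \<open>e > 0\<close> \<open>x < y\<close> by (auto simp: h_def min_def)
    then have "x + h \<in> U" using e by (auto simp: dist_real_def subset_iff)
    then have "ext_deriv 1 g x \<le> ext_deriv 1 g (x + h)" "ext_deriv 1 g (x + h) \<le> ext_deriv 1 g y"
      using that h mono[of x "x + h"] mono[of "x + h" y] by auto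
    then show False using d[of h] h eq by simp
  qed
  show ?thesis
  proof (rule inj_onI)
    fix x y assume "x \<in> U" "y \<in> U" "ext_deriv 1 g x = ext_deriv 1 g y"
    then show "x = y" using neq[of x y] neq[of y x] by (cases x y rule: linorder_cases) auto
  qed
qed

lemma fenchel_real_at_slope:
  assumes "proper_fun g" "ereal_convex g" "thrice_differentiable_on g U" "z \<in> U"
  shows "fenchel_real g (ext_deriv 1 g z) = ereal (ext_deriv 1 g z * z - real_of_ereal (g z))"
proof (rule antisym)
  show "fenchel_real g (ext_deriv 1 g z) \<le> ereal (ext_deriv 1 g z * z - real_of_ereal (g z))"
    unfolding fenchel_real_def
  proof (rule SUP_least)
    fix y
    show "ereal (ext_deriv 1 g z * y) - g y \<le> ereal (ext_deriv 1 g z * z - real_of_ereal (g z))"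
      using convex_derivative_supports[OF assms, of y] assms(1)
      by (cases "g y") (auto simp: proper_fun_def algebra_simps)
  qed
  show "ereal (ext_deriv 1 g z * z - real_of_ereal (g z)) \<le> fenchel_real g (ext_deriv 1 g z)"
    unfolding fenchel_real_def
    by (rule SUP_upper2[of z]) (use thrice_differentiable_onD(1)[OF assms(3,4)] in \<open>auto, metis ereal_minus(1) order_refl\<close>)
qed

text \<open>Near \<open>0\<close> the derivative of the conjugate is the inverse function \<open>h\<close> of the derivative of \<open>g\<close>,
  because \<open>q * h q - g (h q)\<close> is the conjugate there and its derivative telescopes to \<open>h q\<close>. Since
  \<open>h' = 1 / g'' \<circ> h\<close> and \<open>h'' = - (g''' / g''^3) \<circ> h\<close>, the bound \<open>c\<close> is exactly the bound
  on the second derivative of \<open>h\<close> in its first-order Taylor expansion at \<open>0\<close>.\<close>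

lemma conjugate_derivative_expansion:
  fixes g :: "real \<Rightarrow> ereal"
  assumes "proper_fun g" "ereal_convex g" "thrice_differentiable_on g U"
    and z0: "z0 \<in> U" "ext_deriv 1 g z0 = 0"
    and bound: "\<And>z. z \<in> U \<Longrightarrow> ext_deriv 2 g z \<noteq> 0 \<and> \<bar>ext_deriv 3 g z / (ext_deriv 2 g z) ^ 3\<bar> \<le> c"
    and range: "{-\<delta><..<\<delta>} \<subseteq> ext_deriv 1 g ` U" and s: "\<bar>s\<bar> < \<delta>"
  shows "\<bar>ext_deriv 1 (fenchel_real g) s - z0 - s / ext_deriv 2 g z0\<bar> \<le> c / 2 * s\<^sup>2"
proof -
  define h where "h = the_inv_into U (ext_deriv 1 g)"
  note D = thrice_differentiable_onD[OF assms(3)]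
  have inj: "inj_on (ext_deriv 1 g) U"
    using convex_derivative_inj_on[OF assms(1-3)] bound by blast
  have h_left: "h (ext_deriv 1 g z) = z" if "z \<in> U" for z
    unfolding h_def using inj that by (rule the_inv_into_f_f)
  have h_U: "h q \<in> U" and h_right: "ext_deriv 1 g (h q) = q" if "\<bar>q\<bar> < \<delta>" for q
  proof -
    obtain z where "z \<in> U" "q = ext_deriv 1 g z" using range \<open>\<bar>q\<bar> < \<delta>\<close> by (force simp: abs_less_iff)
    then show "h q \<in> U" "ext_deriv 1 g (h q) = q" using h_left by auto
  qed
  have h0: "h 0 = z0" using h_left z0 by force
  have Dh: "(h has_real_derivative inverse (ext_deriv 2 g (h q))) (at q)" if "\<bar>q\<bar> < \<delta>" for q
    unfolding has_field_derivative_def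
  proof (rule has_derivative_inverse_strong_x)
    show "open U" using assms(3) by (simp add: thrice_differentiable_on_def)
    show "h q \<in> U" using h_U that .
    show "continuous_on U (ext_deriv 1 g)"
      using D(3) by (meson DERIV_isCont continuous_at_imp_continuous_on)
    show "(ext_deriv 1 g has_derivative (*) (ext_deriv 2 g (h q))) (at (h q))"
      using D(3)[OF h_U[OF that]] by (simp add: has_field_derivative_def)
    show "(*) (ext_deriv 2 g (h q)) \<circ> (*) (inverse (ext_deriv 2 g (h q))) = id"
      using bound[OF h_U[OF that]] by (auto simp: fun_eq_iff)
  qed (use h_left h_right[OF that] in auto)
  have Dh': "((\<lambda>q. inverse (ext_deriv 2 g (h q))) has_real_derivative
      - (ext_deriv 3 g (h q) / ext_deriv 2 g (h q) ^ 3)) (at q)" if "\<bar>q\<bar> < \<delta>" for q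
  proof -
    have "((\<lambda>q. ext_deriv 2 g (h q)) has_real_derivative
        ext_deriv 3 g (h q) * inverse (ext_deriv 2 g (h q))) (at q)"
      by (rule DERIV_chain2[OF D(4)[OF h_U[OF that]] Dh[OF that]])
    from DERIV_inverse'[OF this] bound[OF h_U[OF that]] show ?thesis
      by (simp add: field_simps power3_eq_cube)
  qed
  have conj: "ext_deriv 1 (fenchel_real g) s = h s"
  proof -
    have "((\<lambda>q. q * h q - real_of_ereal (g (h q))) has_real_derivative
      (1 * h s + inverse (ext_deriv 2 g (h s)) * s) - ext_deriv 1 g (h s) * inverse (ext_deriv 2 g (h s))) (at s)"
      by (rule DERIV_diff[OF DERIV_mult[OF DERIV_ident Dh[OF s]] DERIV_chain2[OF D(2)[OF h_U[OF s]] Dh[OF s]]])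
    then have "((\<lambda>q. q * h q - real_of_ereal (g (h q))) has_real_derivative h s) (at s)"
      using h_right[OF s] by (simp add: mult.commute)
    moreover have "\<forall>\<^sub>F q in nhds s. real_of_ereal (fenchel_real g q) = q * h q - real_of_ereal (g (h q))"
    proof -
      have "\<forall>\<^sub>F q in nhds s. q \<in> {-\<delta><..<\<delta>}" using s by (intro eventually_nhds_in_open) auto
      then show ?thesis
      proof eventually_elim
        case (elim q)
        then have q: "\<bar>q\<bar> < \<delta>" by auto
        show ?case using fenchel_real_at_slope[OF assms(1-3) h_U[OF q]] h_right[OF q] by simp
      qed
    qed
    ultimately have "((\<lambda>q. real_of_ereal (fenchel_real g q)) has_real_derivative h s) (at s)"
      by (simp add: DERIV_cong_ev)
    then show ?thesis by (simp add: ext_deriv_def DERIV_imp_deriv)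
  qed
  have "\<bar>h s - z0 - s / ext_deriv 2 g z0\<bar> \<le> c / 2 * s\<^sup>2"
  proof (cases "s = 0")
    case True
    then show ?thesis using h0 by simp
  next
    case False
    define diff where "diff = (\<lambda>m::nat. if m = 0 then h else if m = 1 then \<lambda>q. inverse (ext_deriv 2 g (h q))
      else (\<lambda>q. - (ext_deriv 3 g (h q) / ext_deriv 2 g (h q) ^ 3)))"
    have "\<exists>t. (if s < 0 then s < t \<and> t < 0 else 0 < t \<and> t < s) \<and>
      h s = (\<Sum>m<2. (diff m 0 / fact m) * (s - 0)^m) + (diff 2 t / fact 2) * (s - 0)^2"
      using s False by (intro Taylor[of 2 diff h "- \<bar>s\<bar>" "\<bar>s\<bar>"]) (auto simp: diff_def less_2_cases_iff intro: Dh Dh')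
    then obtain t where between: "if s < 0 then s < t \<and> t < 0 else 0 < t \<and> t < s"
      and taylor: "h s = (\<Sum>m<2. (diff m 0 / fact m) * (s - 0)^m) + (diff 2 t / fact 2) * (s - 0)^2"
      by blast
    have t: "\<bar>t\<bar> < \<delta>" using between s by (auto split: if_splits)
    from taylor have "h s - z0 - s / ext_deriv 2 g z0 = - (ext_deriv 3 g (h t) / ext_deriv 2 g (h t) ^ 3) / 2 * s\<^sup>2"
      by (simp add: diff_def h0 numeral_2_eq_2 field_simps)
    then have "\<bar>h s - z0 - s / ext_deriv 2 g z0\<bar> = \<bar>ext_deriv 3 g (h t) / ext_deriv 2 g (h t) ^ 3\<bar> / 2 * s\<^sup>2"
      by (simp add: abs_mult)
    also have "\<dots> \<le> c / 2 * s\<^sup>2"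
      using bound[OF h_U[OF t]] by (intro mult_right_mono) auto
    finally show ?thesis .
  qed
  then show ?thesis unfolding conj .
qed

section \<open>Young and integral inequalities\<close>

lemma conj_inverse_young:
  assumes "x \<ge> 0"
  shows "ereal (\<alpha> * x) \<le> conj_inverse \<Phi> \<alpha> + ext_inverse \<Phi> x"
proof -
  have "ereal (\<alpha> * x) - ext_inverse \<Phi> x \<le> conj_inverse \<Phi> \<alpha>"
    unfolding conj_inverse_def using assms by (intro SUP_upper) auto
  then show ?thesis
    by (cases "conj_inverse \<Phi> \<alpha>") (auto simp: ext_inverse_def split: if_splits)
qed

lemma conj_inverse_young_at_value:
  assumes "strict_mono_on {0..} \<Phi>" "d \<ge> 0" "\<Phi> d \<ge> 0"
  shows "ereal (\<alpha> * \<Phi> d) \<le> conj_inverse \<Phi> \<alpha> + ereal d"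
proof -
  have "ext_inverse \<Phi> (\<Phi> d) = ereal d"
    using assms(2) the_inv_into_f_f[OF strict_mono_on_imp_inj_on[OF assms(1)], of d]
    by (simp add: ext_inverse_def)
  then show ?thesis using conj_inverse_young[OF assms(3), of \<alpha> \<Phi>] by simp
qed

text \<open>Integrating an error of size \<open>b\<close> against \<open>g\<close> costs at most \<open>b * \<bar>g t\<bar>\<close> at each point, and
  completing the square absorbs this into \<open>\<kappa> * (g t)\<^sup>2\<close> up to the constant \<open>b\<^sup>2 / (4 * \<kappa>)\<close>,
  which is integrable because the measure is finite.\<close>

lemma linearization_error_le:
  fixes k f0 w g :: "'a \<Rightarrow> real"
  assumes "finite_measure M" "\<kappa> > 0"
    and k: "has_bochner_integral M (\<lambda>t. k t * g t) K"
    and f0: "has_bochner_integral M (\<lambda>t. f0 t * g t) F"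
    and w: "has_bochner_integral M (\<lambda>t. w t * g t) W"
    and g: "integrable M (\<lambda>t. (g t)\<^sup>2)"
    and err: "AE t in M. \<bar>k t - f0 t + \<alpha> * w t\<bar> \<le> b"
  shows "K - F + \<alpha> * W - \<kappa> * (\<integral>t. (g t)\<^sup>2 \<partial>M) \<le> b\<^sup>2 / (4 * \<kappa>) * measure M (space M)"
proof -
  interpret finite_measure M by fact
  have I: "has_bochner_integral M (\<lambda>t. k t * g t - f0 t * g t + \<alpha> * (w t * g t) - \<kappa> * (g t)\<^sup>2)
      (K - F + \<alpha> * W - \<kappa> * (\<integral>t. (g t)\<^sup>2 \<partial>M))"
    by (intro has_bochner_integral_diff has_bochner_integral_add has_bochner_integral_mult_right
        k f0 w has_bochner_integral_integrable g)
  have "(\<integral>t. k t * g t - f0 t * g t + \<alpha> * (w t * g t) - \<kappa> * (g t)\<^sup>2 \<partial>M) \<le> (\<integral>t. b\<^sup>2 / (4 * \<kappa>) \<partial>M)"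
  proof (rule integral_mono_AE)
    show "AE t in M. k t * g t - f0 t * g t + \<alpha> * (w t * g t) - \<kappa> * (g t)\<^sup>2 \<le> b\<^sup>2 / (4 * \<kappa>)"
      using err
    proof eventually_elim
      case (elim t)
      have "k t * g t - f0 t * g t + \<alpha> * (w t * g t) = (k t - f0 t + \<alpha> * w t) * g t"
        by (simp add: algebra_simps)
      also have "\<dots> \<le> b * \<bar>g t\<bar>"
        using elim by (metis abs_ge_self abs_mult order_trans mult_right_mono abs_ge_zero)
      also have "\<dots> \<le> \<kappa> * (g t)\<^sup>2 + b\<^sup>2 / (4 * \<kappa>)"
      proof -
        have "0 \<le> (2 * \<kappa> * \<bar>g t\<bar> - b)\<^sup>2 / (4 * \<kappa>)" using \<open>\<kappa> > 0\<close> by simp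
        also have "\<dots> = \<kappa> * (g t)\<^sup>2 + b\<^sup>2 / (4 * \<kappa>) - b * \<bar>g t\<bar>"
          using \<open>\<kappa> > 0\<close> by (simp add: power2_diff power_mult_distrib field_simps power2_eq_square)
        finally show ?thesis by simp
      qed
      finally show ?case by simp
    qed
  qed (use I in \<open>auto simp: has_bochner_integral_iff\<close>)
  then show ?thesis using I by (simp add: has_bochner_integral_iff mult.commute)
qed

section \<open>The convergence rate\<close>

theorem theorem6p2:
  fixes \<Gamma> :: "(real^2) set"
    and A :: "'x::banach \<Rightarrow>\<^sub>L 'y::banach"
    and rep :: "'y \<Rightarrow> real^2 \<Rightarrow> real"
    and f :: 'y
    and \<phi> :: "real^2 \<Rightarrow> real \<Rightarrow> ereal"
    and H :: "'y \<Rightarrow> ereal"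
    and R :: "'x \<Rightarrow> ereal"
    and u_dag u0 :: 'x
    and u :: "real \<Rightarrow> 'x"
    and p :: "real \<Rightarrow> ('y \<Rightarrow>\<^sub>L real)" and p_fun :: "real \<Rightarrow> real^2 \<Rightarrow> real"
    and p_dag :: "'y \<Rightarrow>\<^sub>L real" and p_dag_fun :: "real^2 \<Rightarrow> real"
    and U :: "real^2 \<Rightarrow> real set" and C_tilde \<delta> :: real
    and w :: 'y
    and \<Phi> :: "real \<Rightarrow> real"
    and \<zeta>_dag :: "real \<Rightarrow> (('y \<Rightarrow>\<^sub>L real) \<Rightarrow>\<^sub>L real)"
    and C :: real
  \<comment> \<open>the domain, the function space and the functionals\<close>
  assumes "bounded \<Gamma>" and "\<Gamma> \<in> sets lebesgue"
    and "function_space \<Gamma> rep"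
    and "\<And>t. t \<in> \<Gamma> \<Longrightarrow> proper_fun (\<phi> t) \<and> ereal_convex (\<phi> t) \<and> lsc (\<phi> t)"
    and "\<And>z. (\<lambda>t. \<phi> t (rep z t)) \<in> borel_measurable (lebesgue_on \<Gamma>)"
    and H_def: "H = fidelity \<Gamma> rep \<phi>"
    and "proper_fun H" and "ereal_convex H" and "lsc H"
    and "proper_fun R" and "ereal_convex R" and "lsc R"
  \<comment> \<open>exact, primal and dual solutions\<close>
    and "is_arg_min R (\<lambda>v. A v = f) u_dag"
    and "\<And>\<alpha>. \<alpha> > 0 \<Longrightarrow> is_arg_min (\<lambda>v. ereal (1 / \<alpha>) * H (A v) + R v) (\<lambda>_. True) (u \<alpha>)"
    and "H (A u0) < \<infinity>" and "R u0 < \<infinity>" and "isCont H (A u0)"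
    and "\<And>\<alpha>. \<alpha> > 0 \<Longrightarrow>
           is_arg_min (\<lambda>q. ereal (1 / \<alpha>) * fenchel H (- \<alpha> *\<^sub>R q) + fenchel R (adjoint_blinfun A q))
             (\<lambda>_. True) (p \<alpha>)"
    and "\<And>\<alpha>. \<alpha> > 0 \<Longrightarrow> acts_by \<Gamma> rep (p \<alpha>) (p_fun \<alpha>)"
  \<comment> \<open>(C1), (C2), (C3)\<close>
    and C1: "AE t in lebesgue_on \<Gamma>. \<exists>V. rep f t \<in> V \<and> thrice_differentiable_on (\<phi> t) V"
    and C2: "AE t in lebesgue_on \<Gamma>. ext_deriv 1 (\<phi> t) (rep f t) = 0 \<and> ext_deriv 2 (\<phi> t) (rep f t) \<noteq> 0"
    and C3: "AE t in lebesgue_on \<Gamma>. rep f t \<in> U t \<and> thrice_differentiable_on (\<phi> t) (U t) \<and>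
           (\<forall>z\<in>U t. ext_deriv 2 (\<phi> t) z \<noteq> 0 \<and>
                    \<bar>ext_deriv 3 (\<phi> t) z / (ext_deriv 2 (\<phi> t) z) ^ 3\<bar> \<le> C_tilde)"
  \<comment> \<open>the neighborhoods in (C3) are uniform in t: in the dual variable they contain a fixed
      interval around 0; without this the claim fails, because no single bound on alpha
      keeps -alpha * p_dag(t) in the range of validity of (C3) for almost all t\<close>
    and C3_uniform: "\<delta> > 0" "AE t in lebesgue_on \<Gamma>. {-\<delta><..<\<delta>} \<subseteq> ext_deriv 1 (\<phi> t) ` U t"
  \<comment> \<open>source condition\<close>
    and "acts_by \<Gamma> rep p_dag p_dag_fun" and "\<exists>M. AE t in lebesgue_on \<Gamma>. \<bar>p_dag_fun t\<bar> \<le> M"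
    and "adjoint_blinfun A p_dag \<in> subdiff R u_dag"
  \<comment> \<open>variational inequality, where w is the element p_dag / phi''(., f) of Y\<close>
    and "\<And>x. x \<ge> 0 \<Longrightarrow> \<Phi> x \<ge> 0" and "\<Phi> 0 = 0"
    and "strict_mono_on {0..} \<Phi>" and "continuous_on {0..} \<Phi>" and "concave_on {0..} \<Phi>"
    and "AE t in lebesgue_on \<Gamma>. rep w t = p_dag_fun t / ext_deriv 2 (\<phi> t) (rep f t)"
    and "\<And>q. bregman (fenchel R) (bidual_embed u_dag) (adjoint_blinfun A q) (adjoint_blinfun A p_dag) \<noteq> \<infinity> \<Longrightarrow>
           (p_dag - q) w \<le>
           \<Phi> (real_of_ereal (bregman (fenchel R) (bidual_embed u_dag) (adjoint_blinfun A q) (adjoint_blinfun A p_dag)))"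
  \<comment> \<open>subgradients of the conjugate fidelity\<close>
    and "\<forall>\<^sub>F \<alpha> in at_right 0.
           \<zeta>_dag \<alpha> \<in> subdiff (fenchel H) (- \<alpha> *\<^sub>R p_dag) \<and>
           (AE t in lebesgue_on \<Gamma>. ext_differentiable_at (fenchel_real (\<phi> t)) (- \<alpha> * p_dag_fun t)) \<and>
           has_bochner_integral (lebesgue_on \<Gamma>)
             (\<lambda>t. ext_deriv 1 (fenchel_real (\<phi> t)) (- \<alpha> * p_dag_fun t) * (p_fun \<alpha> t - p_dag_fun t))
             (\<zeta>_dag \<alpha> (p \<alpha> - p_dag))"
    and "C > 0"
    and "\<forall>\<^sub>F \<alpha> in at_right 0.
           ereal (sym_bregman (bidual_embed (A (u \<alpha>))) (\<zeta>_dag \<alpha>) (- \<alpha> *\<^sub>R p \<alpha>) (- \<alpha> *\<^sub>R p_dag))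
           \<ge> ereal (C * \<alpha>\<^sup>2) * (L2_norm \<Gamma> (\<lambda>t. p_fun \<alpha> t - p_dag_fun t))\<^sup>2"
  shows "\<exists>C_bar>0. \<forall>\<^sub>F \<alpha> in at_right 0.
           bregman R (adjoint_blinfun A p_dag) (u \<alpha>) u_dag
           \<le> 2 * conj_inverse \<Phi> \<alpha> + ext_inverse \<Phi> (\<alpha>\<^sup>2 * C_bar)"
proof -
  let ?M = "lebesgue_on \<Gamma>"
  let ?w = "\<lambda>t. p_dag_fun t / ext_deriv 2 (\<phi> t) (rep f t)"
  have fin: "finite_measure ?M"
    by (intro finite_measure_lebesgue_on bounded_set_imp_lmeasurable assms(1,2))
  obtain M0 where "AE t in ?M. \<bar>p_dag_fun t\<bar> \<le> M0" using assms(26) by blast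
  define M where "M = \<bar>M0\<bar>"
  have M: "AE t in ?M. \<bar>p_dag_fun t\<bar> \<le> M" "M \<ge> 0"
    using \<open>AE t in ?M. \<bar>p_dag_fun t\<bar> \<le> M0\<close> unfolding M_def by (auto elim: eventually_mono)
  define c where "c = \<bar>C_tilde\<bar> / 2 * M\<^sup>2"
  define C_bar where "C_bar = c\<^sup>2 / (4 * C) * measure ?M (space ?M) + 1"
  have "C_bar > 0" unfolding C_bar_def using \<open>C > 0\<close> by (intro add_nonneg_pos mult_nonneg_nonneg) auto
  have Au: "A u_dag = f" using assms(13) by (simp add: is_arg_min_def)
  (* all alpha with alpha * M < delta keep -alpha * p_dag(t) in the dual interval of validity,
     for almost all t at once *)
  have expansion: "AE t in ?M. \<bar>ext_deriv 1 (fenchel_real (\<phi> t)) (- \<alpha> * p_dag_fun t) - rep f t + \<alpha> * ?w t\<bar> \<le> c * \<alpha>\<^sup>2"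
    if \<alpha>: "\<alpha> > 0" "\<alpha> * M < \<delta>" for \<alpha>
  proof -
    have "AE t in ?M. t \<in> \<Gamma>" using AE_space[of ?M] by (simp add: space_restrict_space)
    with C2 C3 C3_uniform(2) M(1) show ?thesis
    proof eventually_elim
      case (elim t)
      have \<phi>: "proper_fun (\<phi> t)" "ereal_convex (\<phi> t)" using assms(4) elim by auto
      have "\<bar>- \<alpha> * p_dag_fun t\<bar> \<le> \<alpha> * M" using elim \<alpha> by (simp add: abs_mult)
      then have small: "\<bar>- \<alpha> * p_dag_fun t\<bar> < \<delta>" using \<alpha> by linarith
      have "\<bar>ext_deriv 1 (fenchel_real (\<phi> t)) (- \<alpha> * p_dag_fun t) - rep f t
          - (- \<alpha> * p_dag_fun t) / ext_deriv 2 (\<phi> t) (rep f t)\<bar> \<le> C_tilde / 2 * (- \<alpha> * p_dag_fun t)\<^sup>2"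
        using elim by (intro conjugate_derivative_expansion[OF \<phi>, where U = "U t" and \<delta> = \<delta>] small) auto
      also have "\<dots> \<le> \<bar>C_tilde\<bar> / 2 * (\<alpha> * M)\<^sup>2"
      proof (rule mult_mono)
        show "(- \<alpha> * p_dag_fun t)\<^sup>2 \<le> (\<alpha> * M)\<^sup>2"
          using \<open>\<bar>- \<alpha> * p_dag_fun t\<bar> \<le> \<alpha> * M\<close> by (metis abs_ge_zero power2_abs power_mono)
      qed auto
      also have "\<dots> = c * \<alpha>\<^sup>2" by (simp add: c_def power_mult_distrib)
      finally show ?case by simp
    qed
  qed
  have "\<forall>\<^sub>F \<alpha> in at_right (0::real). 0 < \<alpha>" by (rule eventually_at_right_less)
  moreover have "\<forall>\<^sub>F \<alpha> in at_right 0. \<alpha> * M < \<delta>"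
  proof -
    have "((\<lambda>\<alpha>. \<alpha> * M) \<longlongrightarrow> 0 * M) (at_right 0)" by (intro tendsto_intros)
    then show ?thesis using \<open>\<delta> > 0\<close> by (intro order_tendstoD(2)) auto
  qed
  moreover note assms(35,37)
  ultimately have "\<forall>\<^sub>F \<alpha> in at_right 0. bregman R (adjoint_blinfun A p_dag) (u \<alpha>) u_dag
           \<le> 2 * conj_inverse \<Phi> \<alpha> + ext_inverse \<Phi> (\<alpha>\<^sup>2 * C_bar)"
  proof eventually_elim
    case (elim \<alpha>)
    let ?g = "\<lambda>t. p_fun \<alpha> t - p_dag_fun t"
    let ?d = "p \<alpha> - p_dag"
    obtain r where "R (u \<alpha>) = ereal r" "fenchel R (adjoint_blinfun A (p \<alpha>)) = ereal (p \<alpha> (A (u \<alpha>)) - r)"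
      using dual_minimizer_extremal[OF assms(7,8,10,11) _ assms(14) assms(15-17) assms(18)] elim(1) by blast
    then obtain D D' where D: "bregman R (adjoint_blinfun A p_dag) (u \<alpha>) u_dag = ereal D"
      and D': "bregman (fenchel R) (bidual_embed u_dag) (adjoint_blinfun A (p \<alpha>)) (adjoint_blinfun A p_dag) = ereal D'"
      and "0 \<le> D'" and sum: "D + D' = ?d (A (u \<alpha>)) - ?d f"
      using bregman_sum[OF Au assms(27)] by blast
    have acts: "has_bochner_integral ?M (\<lambda>t. rep z t * ?g t) (?d z)" for z
      using has_bochner_integral_diff[of ?M "\<lambda>t. rep z t * p_fun \<alpha> t" "p \<alpha> z" "\<lambda>t. rep z t * p_dag_fun t" "p_dag z"]
        assms(19)[OF elim(1)] assms(25)
      by (simp add: acts_by_def blinfun.diff_left right_diff_distrib)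
    have sym: "sym_bregman (bidual_embed (A (u \<alpha>))) (\<zeta>_dag \<alpha>) (- \<alpha> *\<^sub>R p \<alpha>) (- \<alpha> *\<^sub>R p_dag)
        = - \<alpha> * (?d (A (u \<alpha>)) - \<zeta>_dag \<alpha> ?d)"
    proof -
      have "- \<alpha> *\<^sub>R p \<alpha> - - \<alpha> *\<^sub>R p_dag = - \<alpha> *\<^sub>R ?d" by (simp add: scaleR_right_diff_distrib)
      then show ?thesis
        unfolding sym_bregman_def
        by (simp only: blinfun.scaleR_right blinfun.diff_left bidual_embed_apply) simp
    qed
    (* the coercivity estimate bounds an infinite norm by a real number, hence the norm is finite *)
    have sq: "integrable ?M (\<lambda>t. (?g t)\<^sup>2)"
    proof (rule ccontr)
      assume "\<not> ?thesis"
      then have "ereal (C * \<alpha>\<^sup>2) * (L2_norm \<Gamma> ?g)\<^sup>2 = \<infinity>"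
        using \<open>C > 0\<close> elim(1) by (simp add: L2_norm_def power2_eq_square)
      then show False using elim(4) by (simp only: ereal_infty_less_eq) simp
    qed
    let ?N = "\<integral>t. (?g t)\<^sup>2 \<partial>?M"
    have "(L2_norm \<Gamma> ?g)\<^sup>2 = ereal ?N"
      using sq by (simp add: L2_norm_def power2_eq_square flip: real_sqrt_mult)
    then have "\<alpha> * (C * \<alpha> * ?N) \<le> \<alpha> * - (?d (A (u \<alpha>)) - \<zeta>_dag \<alpha> ?d)"
      using elim(4) unfolding sym by (simp add: power2_eq_square algebra_simps)
    then have coercive: "C * \<alpha> * ?N \<le> \<zeta>_dag \<alpha> ?d - ?d (A (u \<alpha>))"
      using elim(1) by (simp only: mult_le_cancel_left_pos)
    (* error b = c * alpha^2 absorbed with weight kappa = C * alpha leaves a term of order alpha^3,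
       that is, alpha times the argument alpha^2 * C_bar of the inverse *)
    have "\<zeta>_dag \<alpha> ?d - ?d f + \<alpha> * ?d w - C * \<alpha> * ?N \<le> (c * \<alpha>\<^sup>2)\<^sup>2 / (4 * (C * \<alpha>)) * measure ?M (space ?M)"
    proof (rule linearization_error_le[OF fin])
      show "AE t in ?M. \<bar>ext_deriv 1 (fenchel_real (\<phi> t)) (- \<alpha> * p_dag_fun t) - rep f t + \<alpha> * rep w t\<bar> \<le> c * \<alpha>\<^sup>2"
        using expansion[OF elim(1,2)] assms(33) by eventually_elim simp
    qed (use elim sq acts \<open>C > 0\<close> in auto)
    also have "\<dots> = \<alpha> * (\<alpha>\<^sup>2 * (C_bar - 1))"
      using elim(1) \<open>C > 0\<close> by (simp add: C_bar_def power2_eq_square)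
    also have "\<dots> \<le> \<alpha> * (\<alpha>\<^sup>2 * C_bar)"
      using elim(1) by (intro mult_left_mono) auto
    finally have "D + D' \<le> \<alpha> * (p_dag - p \<alpha>) w + \<alpha> * (\<alpha>\<^sup>2 * C_bar)"
      using sum coercive by (simp add: blinfun.diff_left right_diff_distrib)
    moreover have "(p_dag - p \<alpha>) w \<le> \<Phi> D'" using assms(34)[of "p \<alpha>"] D' by simp
    then have "\<alpha> * (p_dag - p \<alpha>) w \<le> \<alpha> * \<Phi> D'" using elim(1) by simp
    ultimately have main: "D \<le> (\<alpha> * \<Phi> D' - D') + \<alpha> * (\<alpha>\<^sup>2 * C_bar)" by linarith
    (* Young's inequality twice: once at Phi D', where the inverse returns the D' to be
       cancelled, and once at alpha^2 * C_bar *)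
    have "ereal (\<alpha> * \<Phi> D') \<le> conj_inverse \<Phi> \<alpha> + ereal D'"
      using \<open>0 \<le> D'\<close> assms(28,30) by (intro conj_inverse_young_at_value) auto
    moreover have "ereal (\<alpha> * (\<alpha>\<^sup>2 * C_bar)) \<le> conj_inverse \<Phi> \<alpha> + ext_inverse \<Phi> (\<alpha>\<^sup>2 * C_bar)"
      using \<open>C_bar > 0\<close> by (intro conj_inverse_young) auto
    ultimately show ?case
      unfolding D using main
      by (cases "conj_inverse \<Phi> \<alpha>"; cases "ext_inverse \<Phi> (\<alpha>\<^sup>2 * C_bar)")
        (auto simp: numeral_eq_ereal)
  qed
  then show ?thesis using \<open>C_bar > 0\<close> by blast
qed

end
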